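(* Let $p,q_1\in(1,\infty)$, $q_2\in[1,\infty]$, $s_1,s_2\in\mathbb R$ and let $r>0$ be such that the functional $\frac1r\|\cdot\|_{B^{s_1}_{p,q_1}}^r$ is convex and differentiable (i.e. $r>1$). Set $s_3=-s_1+(s_2-s_1)(q_1-1)$ and $q_3=\frac{q_2}{q_1-1}$, and assume that the chosen wavelet system has smoothness index $\sigma>\max\{|s_1|,|s_2|,|s_3|\}$. Let $f^*\in\partial\,\frac1r\|f\|_{B^{s_1}_{p,q_1}}^r$ (subdifferential of $\frac1r\|\cdot\|_{B^{s_1}_{p,q_1}}^r$ at $f$). Then $f\in B^{s_1}_{p,q_1}\cap B^{s_2}_{p,q_2}$ if and only if $f^*\in B^{-s_1}_{p',q_1'}\cap B^{s_3}_{p',q_3}$. Furthermore $$\|f^*\|_{B^{s_3}_{p',q_3}}=\|f\|_{B^{s_1}_{p,q_1}}^{\,r-q_1}\,\|f\|_{B^{s_2}_{p,q_2}}^{\,q_1-1}.$$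
   Context: All norms in this statement are the wavelet norms defined as follows. $\Omega$ is a bounded Lipschitz domain in $\mathbb R^d$ or the torus $\mathbb T^d=\mathbb R^d/\mathbb Z^d$; $p'$ denotes the Hölder conjugate. Let $I=\{(j,l):j\in\mathbb N_0,\ l\in I_j\}$ with countable index sets $I_j$, let $(\phi_{j,l})_{(j,l)\in I}$ be an orthonormal system in $L^2(\Omega)$ with $\phi_{j,l}\in C^\sigma(\overline\Omega,\mathbb R)$ for some $\sigma\in\mathbb N$, and put $\lambda_{j,l}(f)=\int_\Omega f\,\phi_{j,l}\,dx$ (understood as a dual pairing for distributions). It is assumed that this wavelet system generates the Besov spaces on $\Omega$: for all $p,q\in[1,\infty]$ and $|s|<\sigma$, a distribution $f$ on $\Omega$ belongs to $B^s_{p,q}=B^s_{p,q}(\Omega)$ if and only if $$\|f\|_{B^s_{p,q}}=\Big[\sum_{j\in\mathbb N_0}2^{jsq}\,2^{jd(\frac12-\frac1p)q}\Big(\sum_{l\in I_j}|\lambda_{j,l}(f)|^p\Big)^{q/p}\Big]^{1/q}$$ is finite (usual modifications if $p=\infty$ or $q=\infty$), this is an equivalent norm on $B^s_{p,q}$, and the decomposition $f=\sum_{(j,l)\in I}\lambda_{j,l}(f)\phi_{j,l}$ is unique, with unconditional convergence in the sense of distributions. If $q_3<1$, the space $B^{s_3}_{p',q_3}$ and its (quasi-)norm are defined by the same formula. The dual of $B^{s_1}_{p,q_1}$ is $B^{-s_1}_{p',q_1'}$, so $f\in B^{s_1}_{p,q_1}$ and $f^*\in B^{-s_1}_{p',q_1'}$.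 For $f=0$ (where $f^*=0$) both sides of the norm identity are read as $0$. *)

theory Defs
  imports "HOL-Analysis.Analysis"
begin

section \<open>Domains, smooth functions and distributions\<close>

text \<open>
  Functions on the torus are functions on \<open>real^'n\<close> that are periodic with respect to the
  integer lattice. The ambient dimension \<open>d\<close> is \<open>CARD('n)\<close>.
\<close>

datatype 'x region = Bounded_Domain "'x set" | Torus

definition bounded_lipschitz_domain :: "(real^'n) set \<Rightarrow> bool" where
  "bounded_lipschitz_domain D \<longleftrightarrow>
     D \<noteq> {} \<and> open D \<and> connected D \<and> bounded D \<and>
     (\<forall>x\<in>frontier D. \<exists>e \<gamma> L \<delta>. norm e = 1 \<and> \<delta> > 0 \<and>
        L-lipschitz_on {y. y \<bullet> e = 0} \<gamma> \<and>
        D \<inter> ball x \<delta> = {y \<in> ball x \<delta>. \<gamma> (y - (y \<bullet> e) *\<^sub>R e) < y \<bullet> e})"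

definition admissible_region :: "(real^'n) region \<Rightarrow> bool" where
  "admissible_region R \<longleftrightarrow> (case R of Bounded_Domain D \<Rightarrow> bounded_lipschitz_domain D | Torus \<Rightarrow> True)"

text \<open>The set over which integrals are taken; for the torus a fundamental cell.\<close>

definition cell :: "(real^'n) region \<Rightarrow> (real^'n) set" where
  "cell R = (case R of Bounded_Domain D \<Rightarrow> D | Torus \<Rightarrow> cbox 0 1)"

definition periodic :: "(real^'n \<Rightarrow> real) \<Rightarrow> bool" where
  "periodic f \<longleftrightarrow> (\<forall>x i. f (x + axis i 1) = f x)"

text \<open>\<open>iter_partial [i1, \<dots>, ik] f\<close> is the iterated partial derivative of \<open>f\<close> in the listed directions.\<close>

primrec iter_partial :: "'n list \<Rightarrow> (real^'n \<Rightarrow> real) \<Rightarrow> (real^'n \<Rightarrow> real)" where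
  "iter_partial [] f = f"
| "iter_partial (i # is) f = (\<lambda>x. frechet_derivative (iter_partial is f) (at x) (axis i 1))"

definition Ck_on :: "nat \<Rightarrow> (real^'n) set \<Rightarrow> (real^'n \<Rightarrow> real) \<Rightarrow> bool" where
  "Ck_on k S f \<longleftrightarrow>
     (\<forall>is. length is < k \<longrightarrow> iter_partial is f differentiable_on S) \<and>
     (\<forall>is. length is \<le> k \<longrightarrow> continuous_on S (iter_partial is f))"

text \<open>
  The space \<open>C^k\<close> on the closure of the region: all partial derivatives up to order \<open>k\<close> exist in
  the open set \<open>D\<close> and extend continuously to its closure.
\<close>

definition Ck_closure :: "nat \<Rightarrow> (real^'n) region \<Rightarrow> (real^'n \<Rightarrow> real) set" where
  "Ck_closure k R = (case R of
     Bounded_Domain D \<Rightarrow> {f. Ck_on k D f \<and>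
       (\<forall>is. length is \<le> k \<longrightarrow>
          (\<exists>g. continuous_on (closure D) g \<and> (\<forall>x\<in>D. g x = iter_partial is f x)))}
   | Torus \<Rightarrow> {f. Ck_on k UNIV f \<and> periodic f})"

text \<open>
  Test functions: smooth functions with compact support in \<open>D\<close> (extended by zero), respectively
  smooth periodic functions.
\<close>

definition test_functions :: "(real^'n) region \<Rightarrow> (real^'n \<Rightarrow> real) set" where
  "test_functions R = {\<eta>. (\<forall>k. Ck_on k UNIV \<eta>) \<and>
     (case R of
        Bounded_Domain D \<Rightarrow> compact (closure {x. \<eta> x \<noteq> 0}) \<and> closure {x. \<eta> x \<noteq> 0} \<subseteq> D
      | Torus \<Rightarrow> periodic \<eta>)}"

definition supported_in :: "(real^'n) region \<Rightarrow> (real^'n) set \<Rightarrow> (real^'n \<Rightarrow> real) \<Rightarrow> bool" where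
  "supported_in R K \<eta> \<longleftrightarrow> (case R of Bounded_Domain D \<Rightarrow> {x. \<eta> x \<noteq> 0} \<subseteq> K | Torus \<Rightarrow> True)"

text \<open>
  Distributions are continuous linear functionals on test functions, continuity being expressed by
  the usual seminorm estimates on compact sets. They are represented as functionals that vanish
  outside the test functions, so that equality of distributions is equality of functionals.
\<close>

definition distributions :: "(real^'n) region \<Rightarrow> ((real^'n \<Rightarrow> real) \<Rightarrow> real) set" where
  "distributions R = {u.
     (\<forall>\<eta>. \<eta> \<notin> test_functions R \<longrightarrow> u \<eta> = 0) \<and>
     (\<forall>\<eta>\<in>test_functions R. \<forall>\<theta>\<in>test_functions R. \<forall>a b.
        u (\<lambda>x. a * \<eta> x + b * \<theta> x) = a * u \<eta> + b * u \<theta>) \<and>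
     (\<forall>K. compact K \<and> K \<subseteq> (case R of Bounded_Domain D \<Rightarrow> D | Torus \<Rightarrow> UNIV) \<longrightarrow>
        (\<exists>C N. \<forall>\<eta>\<in>test_functions R. \<forall>M.
           supported_in R K \<eta> \<and> (\<forall>is x. length is \<le> N \<longrightarrow> \<bar>iter_partial is \<eta> x\<bar> \<le> M)
             \<longrightarrow> \<bar>u \<eta>\<bar> \<le> C * M))}"

definition regular_distribution ::
  "(real^'n) region \<Rightarrow> (real^'n \<Rightarrow> real) \<Rightarrow> (real^'n \<Rightarrow> real) \<Rightarrow> real" where
  "regular_distribution R h =
     (\<lambda>\<eta>. if \<eta> \<in> test_functions R then LINT x:cell R|lborel. h x * \<eta> x else 0)"

section \<open>Linear spaces of functionals and subdifferentials\<close>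

definition lin_comb :: "real \<Rightarrow> ('t \<Rightarrow> real) \<Rightarrow> real \<Rightarrow> ('t \<Rightarrow> real) \<Rightarrow> 't \<Rightarrow> real" where
  "lin_comb a u b v = (\<lambda>\<eta>. a * u \<eta> + b * v \<eta>)"

definition linear_space :: "('t \<Rightarrow> real) set \<Rightarrow> bool" where
  "linear_space X \<longleftrightarrow>
     (\<lambda>_. 0) \<in> X \<and> (\<forall>u\<in>X. \<forall>v\<in>X. \<forall>a b. lin_comb a u b v \<in> X)"

definition linear_functional_on :: "('t \<Rightarrow> real) set \<Rightarrow> (('t \<Rightarrow> real) \<Rightarrow> real) \<Rightarrow> bool" where
  "linear_functional_on X T \<longleftrightarrow>
     (\<forall>u\<in>X. \<forall>v\<in>X. \<forall>a b. T (lin_comb a u b v) = a * T u + b * T v)"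

text \<open>A Banach space, with norm \<open>N\<close>, that is continuously embedded into the distributions.\<close>

definition banach_space_of_distributions ::
  "(real^'n) region \<Rightarrow> ((real^'n \<Rightarrow> real) \<Rightarrow> real) set \<Rightarrow> (((real^'n \<Rightarrow> real) \<Rightarrow> real) \<Rightarrow> real) \<Rightarrow> bool"
  where
  "banach_space_of_distributions R X N \<longleftrightarrow>
     X \<subseteq> distributions R \<and> linear_space X \<and>
     (\<forall>u\<in>X. N u \<ge> 0 \<and> (N u = 0 \<longleftrightarrow> u = (\<lambda>_. 0))) \<and>
     (\<forall>u\<in>X. \<forall>a. N (\<lambda>\<eta>. a * u \<eta>) = \<bar>a\<bar> * N u) \<and>
     (\<forall>u\<in>X. \<forall>v\<in>X. N (\<lambda>\<eta>. u \<eta> + v \<eta>) \<le> N u + N v) \<and>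
     (\<forall>w. (\<forall>n. w n \<in> X) \<and> (\<forall>e>0. \<exists>n0. \<forall>m\<ge>n0. \<forall>n\<ge>n0. N (lin_comb 1 (w m) (-1) (w n)) < e) \<longrightarrow>
        (\<exists>u\<in>X. (\<lambda>n. N (lin_comb 1 (w n) (-1) u)) \<longlonglongrightarrow> 0)) \<and>
     (\<forall>\<eta>\<in>test_functions R. \<exists>C. \<forall>u\<in>X. \<bar>u \<eta>\<bar> \<le> C * N u)"

text \<open>
  The subdifferential at \<open>f\<close> of a function \<open>F\<close> on the normed space \<open>X\<close> with norm \<open>N\<close>: a set of
  continuous linear functionals on \<open>X\<close>.
\<close>

definition subdifferential ::
  "('t \<Rightarrow> real) set \<Rightarrow> (('t \<Rightarrow> real) \<Rightarrow> real) \<Rightarrow> (('t \<Rightarrow> real) \<Rightarrow> real) \<Rightarrow> ('t \<Rightarrow> real)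
     \<Rightarrow> (('t \<Rightarrow> real) \<Rightarrow> real) set" where
  "subdifferential X N F f = {T.
     linear_functional_on X T \<and> (\<exists>C. \<forall>g\<in>X. \<bar>T g\<bar> \<le> C * N g) \<and>
     (\<forall>g\<in>X. F g \<ge> F f + T (lin_comb 1 g (-1) f))}"

section \<open>Wavelet norms\<close>

text \<open>
  Powers of extended nonnegative reals. Only used with a positive exponent or for a finite base;
  \<open>0\<close> is mapped to \<open>0\<close> for every exponent.
\<close>

definition epowr :: "ennreal \<Rightarrow> real \<Rightarrow> ennreal" where
  "epowr x a = (if x = \<infinity> then \<infinity> else ennreal (enn2real x powr a))"

text \<open>The \<open>\<ell>^q\<close> (quasi-)norm for \<open>0 < q \<le> \<infinity>\<close>.\<close>

definition lq_norm :: "ennreal \<Rightarrow> 'i set \<Rightarrow> ('i \<Rightarrow> ennreal) \<Rightarrow> ennreal" where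
  "lq_norm q A a =
     (if q = \<infinity> then (SUP i\<in>A. a i)
      else epowr (\<Sum>\<^sub>\<infinity>i\<in>A. epowr (a i) (enn2real q)) (1 / enn2real q))"

text \<open>
  The Besov sequence norm in dimension \<open>d\<close>. The number \<open>enn2real (inverse p)\<close> is \<open>1/p\<close>,
  and \<open>0\<close> for \<open>p = \<infinity>\<close>.
\<close>

definition besov_seq_norm ::
  "nat \<Rightarrow> (nat \<Rightarrow> 'l set) \<Rightarrow> real \<Rightarrow> ennreal \<Rightarrow> ennreal \<Rightarrow> (nat \<Rightarrow> 'l \<Rightarrow> real) \<Rightarrow> ennreal" where
  "besov_seq_norm d I s p q c =
     lq_norm q UNIV (\<lambda>j.
       ennreal (2 powr (real j * s) * 2 powr (real j * real d * (1/2 - enn2real (inverse p)))) *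
       lq_norm p (I j) (\<lambda>l. ennreal \<bar>c j l\<bar>))"

text \<open>
  \<open>wavelet\<close> is the system \<open>\<phi>\<close> with indices \<open>l \<in> idx j\<close> on level \<open>j\<close>.
  \<open>pairing u \<psi>\<close> is the dual pairing \<open>\<integral> u \<psi> dx\<close>, where \<open>\<psi>\<close> is \<open>smoothness\<close> many times continuously
  differentiable up to the boundary. Such a \<open>\<psi>\<close> need not be a test function, so the pairing exists
  only for the distributions in \<open>pairable\<close>. \<open>given_space s p q\<close> is the Besov space with indices
  \<open>s, p, q\<close> for \<open>p, q \<ge> 1\<close>, and \<open>given_norm s p q\<close> its given norm. No boundary convention is
  fixed for Besov spaces on a domain: any scale of spaces generated by the wavelet system is admitted.
\<close>

record ('x, 'l) wavelet_setting =
  region :: "'x region"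
  smoothness :: nat
  idx :: "nat \<Rightarrow> 'l set"
  wavelet :: "nat \<Rightarrow> 'l \<Rightarrow> 'x \<Rightarrow> real"
  pairable :: "(('x \<Rightarrow> real) \<Rightarrow> real) set"
  pairing :: "(('x \<Rightarrow> real) \<Rightarrow> real) \<Rightarrow> ('x \<Rightarrow> real) \<Rightarrow> real"
  given_space :: "real \<Rightarrow> ennreal \<Rightarrow> ennreal \<Rightarrow> (('x \<Rightarrow> real) \<Rightarrow> real) set"
  given_norm :: "real \<Rightarrow> ennreal \<Rightarrow> ennreal \<Rightarrow> (('x \<Rightarrow> real) \<Rightarrow> real) \<Rightarrow> real"

definition coeff ::
  "('x, 'l) wavelet_setting \<Rightarrow> nat \<Rightarrow> 'l \<Rightarrow> (('x \<Rightarrow> real) \<Rightarrow> real) \<Rightarrow> real" where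
  "coeff W j l u = pairing W u (wavelet W j l)"

definition wavelet_norm ::
  "(real^'n, 'l) wavelet_setting \<Rightarrow> real \<Rightarrow> ennreal \<Rightarrow> ennreal \<Rightarrow> ((real^'n \<Rightarrow> real) \<Rightarrow> real) \<Rightarrow> ennreal"
  where
  "wavelet_norm W s p q u = besov_seq_norm CARD('n) (idx W) s p q (\<lambda>j l. coeff W j l u)"

text \<open>For \<open>p < 1\<close> or \<open>q < 1\<close> the Besov space is defined by the wavelet quasi-norm.\<close>

definition besov ::
  "(real^'n, 'l) wavelet_setting \<Rightarrow> real \<Rightarrow> ennreal \<Rightarrow> ennreal \<Rightarrow> ((real^'n \<Rightarrow> real) \<Rightarrow> real) set" where
  "besov W s p q =
     (if 1 \<le> p \<and> 1 \<le> q then given_space W s p q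
      else {u \<in> pairable W. wavelet_norm W s p q u < \<infinity>})"

definition orthonormal_wavelets :: "(real^'n, 'l) wavelet_setting \<Rightarrow> bool" where
  "orthonormal_wavelets W \<longleftrightarrow>
     (\<forall>j. countable (idx W j)) \<and>
     (\<forall>j. \<forall>l\<in>idx W j. wavelet W j l \<in> Ck_closure (smoothness W) (region W)) \<and>
     (\<forall>j. \<forall>l\<in>idx W j. \<forall>j'. \<forall>l'\<in>idx W j'.
        (LINT x:cell (region W)|lborel. wavelet W j l x * wavelet W j' l' x)
          = (if j = j' \<and> l = l' then 1 else 0))"

text \<open>
  The dual pairing is bilinear; it is the evaluation of distributions at test functions and the
  integral for integrable functions.
\<close>

definition dual_pairing :: "(real^'n, 'l) wavelet_setting \<Rightarrow> bool" where
  "dual_pairing W \<longleftrightarrow>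
     pairable W \<subseteq> distributions (region W) \<and> linear_space (pairable W) \<and>
     (\<forall>\<psi>\<in>Ck_closure (smoothness W) (region W). linear_functional_on (pairable W) (\<lambda>u. pairing W u \<psi>)) \<and>
     (\<forall>u\<in>pairable W. linear_functional_on (Ck_closure (smoothness W) (region W)) (pairing W u)) \<and>
     (\<forall>u\<in>pairable W. \<forall>\<eta>\<in>test_functions (region W). pairing W u \<eta> = u \<eta>) \<and>
     (\<forall>h. set_integrable lborel (cell (region W)) h \<longrightarrow>
        regular_distribution (region W) h \<in> pairable W \<and>
        (\<forall>\<psi>\<in>Ck_closure (smoothness W) (region W).
           pairing W (regular_distribution (region W) h) \<psi>
             = (LINT x:cell (region W)|lborel. h x * \<psi> x)))"

text \<open>
  \<open>expansion W c u\<close>: the series of all \<open>c j l * wavelet W j l\<close> converges to \<open>u\<close> unconditionally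
  in the sense of distributions.
\<close>

definition expansion ::
  "(real^'n, 'l) wavelet_setting \<Rightarrow> (nat \<Rightarrow> 'l \<Rightarrow> real) \<Rightarrow> ((real^'n \<Rightarrow> real) \<Rightarrow> real) \<Rightarrow> bool" where
  "expansion W c u \<longleftrightarrow> (\<forall>\<eta>\<in>test_functions (region W).
     ((\<lambda>(j, l). c j l * regular_distribution (region W) (wavelet W j l) \<eta>) has_sum u \<eta>)
       (SIGMA j:UNIV. idx W j))"

text \<open>
  The wavelet system generates the Besov spaces. Uniqueness of the expansion is uniqueness among
  coefficient families with finite Besov sequence norm: without such a bound even the zero
  distribution may have nontrivial expansions, since wavelets are only finitely smooth.
\<close>

definition generates_besov_spaces :: "(real^'n, 'l) wavelet_setting \<Rightarrow> bool" where
  "generates_besov_spaces W \<longleftrightarrow>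
     (\<forall>s p q. \<bar>s\<bar> < real (smoothness W) \<and> 1 \<le> p \<and> 1 \<le> q \<longrightarrow>
        banach_space_of_distributions (region W) (given_space W s p q) (given_norm W s p q) \<and>
        given_space W s p q = {u \<in> pairable W. wavelet_norm W s p q u < \<infinity>} \<and>
        (\<exists>C>0. \<forall>u\<in>given_space W s p q.
           ennreal (given_norm W s p q u) \<le> ennreal C * wavelet_norm W s p q u \<and>
           wavelet_norm W s p q u \<le> ennreal (C * given_norm W s p q u)) \<and>
        (\<forall>u\<in>given_space W s p q. expansion W (\<lambda>j l. coeff W j l u) u \<and>
           (\<forall>c. besov_seq_norm CARD('n) (idx W) s p q c < \<infinity> \<and> expansion W c u \<longrightarrow>
              (\<forall>j. \<forall>l\<in>idx W j. c j l = coeff W j l u))))"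

definition besov_wavelet_system :: "(real^'n, 'l) wavelet_setting \<Rightarrow> bool" where
  "besov_wavelet_system W \<longleftrightarrow>
     admissible_region (region W) \<and> smoothness W \<ge> 1 \<and> orthonormal_wavelets W \<and>
     dual_pairing W \<and> generates_besov_spaces W"

text \<open>
  The functional on the Besov space with indices \<open>s, p, q\<close> that represents an element \<open>v\<close> of its
  dual, the Besov space with indices \<open>-s, p', q'\<close>. It extends the \<open>L^2\<close> inner product
  of \<open>v\<close> and \<open>g\<close>, written in the orthonormal system.
\<close>

definition dual_functional ::
  "('x, 'l) wavelet_setting \<Rightarrow> (('x \<Rightarrow> real) \<Rightarrow> real) \<Rightarrow> (('x \<Rightarrow> real) \<Rightarrow> real) \<Rightarrow> real" where
  "dual_functional W v g =
     (\<Sum>\<^sub>\<infinity>(j, l)\<in>(SIGMA j:UNIV. idx W j). coeff W j l v * coeff W j l g)"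

text \<open>The subdifferential of \<open>(1/r) * norm^r\<close> at \<open>f\<close>, with the dual space identified as above.\<close>

definition besov_subdifferential ::
  "(real^'n, 'l) wavelet_setting \<Rightarrow> real \<Rightarrow> real \<Rightarrow> real \<Rightarrow> real \<Rightarrow> ((real^'n \<Rightarrow> real) \<Rightarrow> real)
     \<Rightarrow> ((real^'n \<Rightarrow> real) \<Rightarrow> real) set" where
  "besov_subdifferential W s p q r f =
     {v \<in> besov W (-s) (ennreal (p / (p - 1))) (ennreal (q / (q - 1))).
        dual_functional W v \<in> subdifferential (besov W s (ennreal p) (ennreal q))
          (\<lambda>g. enn2real (wavelet_norm W s (ennreal p) (ennreal q) g))
          (\<lambda>g. (1 / r) * enn2real (wavelet_norm W s (ennreal p) (ennreal q) g) powr r) f}"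

end

theory Submission
  imports Defs
begin

text \<open>
  Testing the subgradient inequality at \<open>f + t \<phi>\<^bsub>j,l\<^esub>\<close> for all real \<open>t\<close> shows that the wavelet
  coefficient of \<open>f*\<close> at \<open>(j,l)\<close> is the corresponding partial derivative of the wavelet norm
  functional at \<open>f\<close>. With \<open>N\<close> the norm of \<open>f\<close> in \<open>B\<^bsup>s1\<^esup>\<^bsub>p,q1\<^esub>\<close>, \<open>w\<^sub>j\<close> its weight on level \<open>j\<close> and \<open>S\<^sub>j\<close> the
  sum of the \<open>\<bar>\<lambda>\<^bsub>j,l\<^esub>(f)\<bar>\<^sup>p\<close> over level \<open>j\<close>, its absolute value is
  \<open>N powr (r - q1) * w\<^sub>j powr q1 * S\<^sub>j powr (q1/p - 1) * \<bar>\<lambda>\<^bsub>j,l\<^esub>(f)\<bar> powr (p - 1)\<close>.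
  Hence the \<open>\<ell>\<close>-norm with exponent \<open>p'\<close> of \<open>f*\<close> on a level is a power of the \<open>\<ell>\<^sup>p\<close>-norm of \<open>f\<close> on that
  level, and \<open>s3\<close>, \<open>q3\<close> are chosen such that the weighted level norms of \<open>f*\<close> are, up to the factor
  \<open>N powr (r - q1)\<close>, those of \<open>f\<close> in \<open>B\<^bsup>s2\<^esup>\<^bsub>p,q2\<^esub>\<close> raised to the power \<open>q1 - 1\<close>.
\<close>

section \<open>Differentiating powers of absolute values along a line\<close>

text \<open>Away from 0, \<open>\<bar>t\<bar>\<close> agrees locally with \<open>sgn x * t\<close>,
  so the usual power rule applies. At 0 the difference quotient is
  \<open>\<bar>h\<bar> powr (p - 1) * sgn h\<close>, which tends to 0 because the exponent is
  positive.\<close>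

lemma has_real_derivative_abs_powr:
  fixes p x :: real
  assumes "1 < p"
  shows "((\<lambda>t. \<bar>t\<bar> powr p) has_real_derivative p * \<bar>x\<bar> powr (p - 1) * sgn x) (at x)"
proof (cases "x = 0")
  case True
  have "((\<lambda>h::real. \<bar>h\<bar> powr (p - 1) * sgn h) \<longlongrightarrow> 0) (at 0)"
  proof (rule tendsto_rabs_zero_cancel, rule tendsto_sandwich[of "\<lambda>_. 0"])
    show "((\<lambda>h::real. \<bar>h\<bar> powr (p - 1)) \<longlongrightarrow> 0) (at 0)"
      using assms by (intro tendsto_zero_powrI[where b="p-1"]) (auto intro!: tendsto_eq_intros)
  qed (auto simp: abs_mult sgn_if)
  moreover have "\<bar>h\<bar> powr p / h = \<bar>h\<bar> powr (p - 1) * sgn h" if "h \<noteq> 0" for h :: real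
    using that by (auto simp: powr_diff sgn_if abs_if field_simps)
  then have "\<forall>\<^sub>F h::real in at 0. \<bar>h\<bar> powr (p - 1) * sgn h = \<bar>h\<bar> powr p / h"
    by (auto simp: eventually_at_filter intro!: always_eventually)
  ultimately show ?thesis
    using True by (auto simp: DERIV_def elim: Lim_transform_eventually)
next
  case False
  have "((\<lambda>t. (sgn x * t) powr p) has_real_derivative p * \<bar>x\<bar> powr (p - 1) * sgn x) (at x)"
    using False by (auto intro!: derivative_eq_intros simp: sgn_if abs_if powr_diff field_simps)
  moreover have "\<forall>\<^sub>F t in nhds x. \<bar>t\<bar> powr p = (sgn x * t) powr p"
  proof (cases "x > 0")
    case True
    then have "\<forall>\<^sub>F t in nhds x. t > 0" by (rule order_tendstoD(1)[OF filterlim_ident])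
    then show ?thesis by eventually_elim (use True in auto)
  next
    case neg: False
    then have "x < 0" using False by simp
    then have "\<forall>\<^sub>F t in nhds x. t < 0" by (rule order_tendstoD(2)[OF filterlim_ident])
    then show ?thesis by eventually_elim (use \<open>x < 0\<close> in auto)
  qed
  ultimately show ?thesis
    by (subst DERIV_cong_ev[OF refl _ refl]) auto
qed

text \<open>
  Where \<open>S = 0\<close> or \<open>N = 0\<close>, the formula for the derivative relies on \<open>0 powr a = 0\<close>, also for
  negative \<open>a\<close>.
\<close>

lemma has_real_derivative_mixed_norm_powr:
  fixes p q r w B D x :: real
  assumes "1 < p" "1 < q" "1 < r" "0 < w" "0 \<le> B" "0 \<le> D"
  defines "S \<equiv> \<bar>x\<bar> powr p + D"
  defines "N \<equiv> (B + (w * S powr (1/p)) powr q) powr (1/q)"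
  shows "((\<lambda>t. (1/r) * ((B + (w * (\<bar>x + t\<bar> powr p + D) powr (1/p)) powr q) powr (1/q)) powr r)
    has_real_derivative N powr (r - q) * w powr q * S powr (q/p - 1) * \<bar>x\<bar> powr (p - 1) * sgn x) (at 0)"
proof -
  have lvl: "(w * y powr (1/p)) powr q = w powr q * y powr (q/p)" if "y \<ge> 0" for y
    using that assms by (simp add: powr_mult powr_powr)
  have S0: "\<bar>x + t\<bar> powr p + D \<ge> 0" for t using assms by simp
  have F: "(\<lambda>t. (1/r) * ((B + (w * (\<bar>x + t\<bar> powr p + D) powr (1/p)) powr q) powr (1/q)) powr r)
     = (\<lambda>t. (1/r) * (B + w powr q * (\<bar>x + t\<bar> powr p + D) powr (q/p)) powr (r/q))"
    by (simp add: lvl[OF S0] powr_powr)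
  have Npow: "N powr (r - q) = (B + w powr q * S powr (q/p)) powr (r/q - 1)"
    using assms lvl[of S] S0[of 0] by (simp add: N_def powr_powr S_def field_simps)
  have d0: "((\<lambda>t. \<bar>x + t\<bar> powr p) has_real_derivative p * \<bar>x\<bar> powr (p - 1) * sgn x) (at 0)"
    using has_real_derivative_abs_powr[OF assms(1), of x] DERIV_shift[of "\<lambda>t. \<bar>t\<bar> powr p" _ 0 x]
    by (simp add: add.commute)
  show ?thesis
  proof (cases "S > 0")
    case True
    then have "B + w powr q * S powr (q/p) > 0" using assms by (simp add: add_nonneg_pos)
    then have pos: "B + w powr q * (\<bar>x + 0\<bar> powr p + D) powr (q/p) > 0" "\<bar>x + 0\<bar> powr p + D > 0"
      using True by (simp_all add: S_def)
    have "((\<lambda>t. \<bar>x + t\<bar> powr p + D) has_real_derivative p * \<bar>x\<bar> powr (p - 1) * sgn x) (at 0)"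
      using DERIV_add[OF d0 DERIV_const] by simp
    note dS = DERIV_fun_powr[OF this pos(2), of "q/p"]
    note dB = DERIV_add[OF DERIV_const[of B] DERIV_cmult[OF dS, of "w powr q"]]
    from DERIV_cmult[OF DERIV_fun_powr[OF dB pos(1), of "r/q"], of "1/r"]
    show ?thesis unfolding F Npow using assms(1-3)
      by (simp add: S_def mult_ac)
  next
    case False
    \<comment> \<open>The power rule requires a positive base, so \<open>S = 0\<close> is treated by
      hand. The inner function is then \<open>\<bar>t\<bar> powr q\<close> with
      \<open>q > 1\<close>, and the claimed derivative is 0 because \<open>x = 0\<close>.\<close>
    then have "x = 0" "D = 0" using assms(6) powr_ge_zero[of "\<bar>x\<bar>" p]
      unfolding S_def by (simp_all add: add_nonneg_eq_0_iff not_less order_antisym_conv)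
    have G: "(\<bar>x + t\<bar> powr p + D) powr (q/p) = \<bar>t\<bar> powr q" for t
      using \<open>x=0\<close> \<open>D=0\<close> assms by (simp add: powr_powr)
    have d: "((\<lambda>t. \<bar>t\<bar> powr a) has_real_derivative 0) (at 0)" if "1 < a" for a :: real
      using has_real_derivative_abs_powr[OF that, of 0] by simp
    show ?thesis
    proof (cases "B > 0")
      case True
      have "((\<lambda>t. (1/r) * (B + w powr q * \<bar>t\<bar> powr q) powr (r/q)) has_real_derivative 0) (at 0)"
        using DERIV_cmult[OF DERIV_fun_powr[OF DERIV_add[OF DERIV_const[of B]
          DERIV_cmult[OF d[OF assms(2)], of "w powr q"]], of "r/q"], of "1/r"] True by simp
      then show ?thesis unfolding F G using \<open>x = 0\<close> by simp
    next
      case False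
      \<comment> \<open>Now the whole function is a multiple of \<open>\<bar>t\<bar> powr r\<close>;
        this is where \<open>r > 1\<close> gives differentiability at the zero sequence.\<close>
      then have "B = 0" using assms by simp
      have E: "(1/r) * (B + w powr q * \<bar>t\<bar> powr q) powr (r/q) = (w powr r / r) * \<bar>t\<bar> powr r" for t
        using \<open>B = 0\<close> assms by (simp add: powr_mult powr_powr)
      have "((\<lambda>t. (w powr r / r) * \<bar>t\<bar> powr r) has_real_derivative 0) (at 0)"
        using DERIV_cmult[OF d[OF assms(3)], of "w powr r / r"] by simp
      then show ?thesis unfolding F G E using \<open>x = 0\<close> by simp
    qed
  qed
qed


section \<open>Powers of extended nonnegative reals and \<open>lq_norm\<close>\<close>

lemma epowr_ennreal [simp]: "0 \<le> x \<Longrightarrow> epowr (ennreal x) a = ennreal (x powr a)"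
  by (simp add: epowr_def)

lemma epowr_0 [simp]: "epowr 0 a = 0"
  by (simp add: epowr_def)

lemma epowr_top [simp]: "epowr top a = top"
  by (simp add: epowr_def)

lemma epowr_epowr: "epowr (epowr x a) b = epowr x (a * b)"
  by (cases x) (simp_all add: powr_powr)

lemma epowr_one [simp]: "epowr x 1 = x"
  by (cases x) simp_all

lemma epowr_cmult: "0 \<le> k \<Longrightarrow> epowr (ennreal k * x) a = ennreal (k powr a) * epowr x a"
  by (cases x; cases "k = 0") (simp_all add: ennreal_mult_top powr_mult flip: ennreal_mult)

lemma epowr_mono: "0 \<le> a \<Longrightarrow> x \<le> y \<Longrightarrow> epowr x a \<le> epowr y a"
  by (cases x; cases y) (auto intro: powr_mono2 simp: top_unique)

text \<open>For \<open>a > 0\<close> the map is monotone with monotone inverse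
  \<open>epowr _ (1/a)\<close>, hence an order isomorphism, and these commute with suprema.\<close>

lemma epowr_SUP:
  assumes "0 < a"
  shows "epowr (SUP i\<in>A. x i) a = (SUP i\<in>A. epowr (x i) a)"
proof (rule antisym)
  have "x i \<le> epowr (SUP i\<in>A. epowr (x i) a) (1/a)" if "i \<in> A" for i
    using epowr_mono[OF _ SUP_upper[OF that, of "\<lambda>i. epowr (x i) a"], of "1/a"] assms
    by (simp add: epowr_epowr)
  then have "(SUP i\<in>A. x i) \<le> epowr (SUP i\<in>A. epowr (x i) a) (1/a)"
    by (rule SUP_least)
  from epowr_mono[OF _ this, of a] show "epowr (SUP i\<in>A. x i) a \<le> (SUP i\<in>A. epowr (x i) a)"
    using assms by (simp add: epowr_epowr)
qed (use assms in \<open>auto intro!: SUP_least epowr_mono SUP_upper\<close>)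

text \<open>Multiplication by a finite constant is continuous on \<open>ennreal\<close>, also at
  \<open>top\<close>, so it commutes with the limit of the finite partial sums.\<close>

lemma infsum_cmult_ennreal:
  fixes f :: "'i \<Rightarrow> ennreal"
  shows "(\<Sum>\<^sub>\<infinity>i\<in>A. ennreal k * f i) = ennreal k * (\<Sum>\<^sub>\<infinity>i\<in>A. f i)"
proof (cases "k > 0")
  case True
  then have "isCont (\<lambda>y. ennreal k * y) (\<Sum>\<^sub>\<infinity>i\<in>A. f i)"
    unfolding isCont_def by (intro tendsto_mult_ennreal tendsto_const tendsto_ident_at) auto
  from infsum_comm_additive_general[OF _ this] show ?thesis
    by (simp add: o_def sum_distrib_left nonneg_summable_on_complete)
qed (simp add: ennreal_neg)

lemma infsum_remove_ennreal:
  fixes f :: "'i \<Rightarrow> ennreal"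
  assumes "i \<in> A"
  shows "infsum f A = f i + infsum f (A - {i})"
  using infsum_insert[of f "A - {i}" i] assms by (simp add: insert_absorb nonneg_summable_on_complete)

text \<open>Since \<open>(y powr a) powr (Q/a) = y powr Q\<close>, taking powers of the entries
  divides the summability exponent by \<open>a\<close>; for \<open>q = top\<close> the supremum
  commutes with the power. With \<open>a = q1 - 1\<close> this explains the choice of
  \<open>q3\<close>, which may lie below 1.\<close>

lemma lq_norm_cmult_powr:
  assumes "1 \<le> q" "0 < a" "0 \<le> k" "\<And>i. i \<in> A \<Longrightarrow> 0 \<le> y i"
  shows "lq_norm (q / ennreal a) A (\<lambda>i. ennreal (k * y i powr a)) =
    ennreal k * epowr (lq_norm q A (\<lambda>i. ennreal (y i))) a"
proof (cases q)
  case top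
  have "(SUP i\<in>A. ennreal (k * y i powr a)) = (SUP i\<in>A. ennreal k * epowr (ennreal (y i)) a)"
    using assms by (intro SUP_cong) (auto simp: ennreal_mult)
  also have "\<dots> = ennreal k * epowr (SUP i\<in>A. ennreal (y i)) a"
    using assms by (simp add: epowr_SUP SUP_mult_left_ennreal)
  finally show ?thesis
    using top assms by (simp add: lq_norm_def ennreal_top_divide)
next
  case (real Q)
  then have Q: "Q \<ge> 1" using assms by simp
  have div: "q / ennreal a = ennreal (Q / a)"
    using real assms by (simp add: divide_ennreal)
  have "(\<Sum>\<^sub>\<infinity>i\<in>A. ennreal ((k * y i powr a) powr (Q/a)))
      = (\<Sum>\<^sub>\<infinity>i\<in>A. ennreal (k powr (Q/a)) * ennreal (y i powr Q))"
    using assms by (intro infsum_cong) (auto simp: powr_mult powr_powr simp flip: ennreal_mult)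
  also have "\<dots> = ennreal (k powr (Q/a)) * (\<Sum>\<^sub>\<infinity>i\<in>A. ennreal (y i powr Q))"
    by (rule infsum_cmult_ennreal)
  finally have *: "(\<Sum>\<^sub>\<infinity>i\<in>A. ennreal ((k * y i powr a) powr (Q/a))) = \<dots>" .
  have "(\<Sum>\<^sub>\<infinity>i\<in>A. epowr (ennreal (k * y i powr a)) (Q/a)) = (\<Sum>\<^sub>\<infinity>i\<in>A. ennreal ((k * y i powr a) powr (Q/a)))"
    "(\<Sum>\<^sub>\<infinity>i\<in>A. epowr (ennreal (y i)) Q) = (\<Sum>\<^sub>\<infinity>i\<in>A. ennreal (y i powr Q))"
    using assms by (auto intro!: infsum_cong)
  then show ?thesis
    using assms(2,3) Q unfolding lq_norm_def div unfolding real
    by (simp add: * epowr_cmult epowr_epowr powr_powr)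
qed

section \<open>Besov sequence norms split into levels\<close>

definition besov_weight :: "nat \<Rightarrow> real \<Rightarrow> real \<Rightarrow> nat \<Rightarrow> real" where
  "besov_weight d s p j = 2 powr (real j * s) * 2 powr (real j * real d * (1/2 - 1/p))"

text \<open>The p-th root is left out so that changing one coefficient changes a single
  summand.\<close>

definition level_sum :: "(nat \<Rightarrow> 'l set) \<Rightarrow> real \<Rightarrow> (nat \<Rightarrow> 'l \<Rightarrow> real) \<Rightarrow> nat \<Rightarrow> ennreal" where
  "level_sum I p c j = (\<Sum>\<^sub>\<infinity>l\<in>I j. ennreal (\<bar>c j l\<bar> powr p))"

lemma besov_weight_pos: "besov_weight d s p j > 0"
  by (simp add: besov_weight_def)

lemma besov_seq_norm_level_sum:
  assumes "0 < p"
  shows "besov_seq_norm d I s (ennreal p) q c =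
    lq_norm q UNIV (\<lambda>j. ennreal (besov_weight d s p j) * epowr (level_sum I p c j) (1/p))"
  using assms by (simp add: besov_seq_norm_def besov_weight_def level_sum_def lq_norm_def
      inverse_ennreal inverse_eq_divide)

lemma besov_seq_norm_finite_exponents:
  assumes "0 < p" "0 < q"
  shows "besov_seq_norm d I s (ennreal p) (ennreal q) c =
    epowr (\<Sum>\<^sub>\<infinity>j. epowr (ennreal (besov_weight d s p j) * epowr (level_sum I p c j) (1/p)) q) (1/q)"
  unfolding besov_seq_norm_level_sum[OF assms(1)] lq_norm_def using assms by simp

lemma level_sum_finite:
  assumes "0 < p" "0 < q" "besov_seq_norm d I s (ennreal p) (ennreal q) c < \<infinity>"
  shows "level_sum I p c j < \<infinity>"
proof (rule ccontr)
  assume "\<not> ?thesis"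
  then have "level_sum I p c j = top" by (simp flip: top.not_eq_extremum)
  then show False
    using assms besov_weight_pos[of d s p j]
    by (simp add: besov_seq_norm_finite_exponents infsum_remove_ennreal[of j UNIV] ennreal_mult_top)
qed

text \<open>\<open>D\<close> collects the other p-th powers on level \<open>j\<close>, and
  \<open>B\<close> the contributions of the other levels. Both are finite because the norm of
  \<open>c\<close> is, and neither involves the coefficient at \<open>(j, l)\<close>. Along this
  coordinate the norm is thus an explicit function of one real variable.\<close>

lemma besov_seq_norm_change_coefficient:
  assumes pq: "0 < p" "0 < q" and fin: "besov_seq_norm d I s (ennreal p) (ennreal q) c < \<infinity>"
    and l: "l \<in> I j"
  obtains B D where "0 \<le> B" "0 \<le> D"
    "\<And>c'. (\<And>j' l'. l' \<in> I j' \<Longrightarrow> (j', l') \<noteq> (j, l) \<Longrightarrow> c' j' l' = c j' l') \<Longrightarrow>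
       level_sum I p c' j = ennreal (\<bar>c' j l\<bar> powr p + D) \<and>
       besov_seq_norm d I s (ennreal p) (ennreal q) c' =
         ennreal ((B + (besov_weight d s p j * (\<bar>c' j l\<bar> powr p + D) powr (1/p)) powr q) powr (1/q))"
proof -
  let ?X = "\<lambda>c j. epowr (ennreal (besov_weight d s p j) * epowr (level_sum I p c j) (1/p)) q"
  define D' where "D' = (\<Sum>\<^sub>\<infinity>l'\<in>I j - {l}. ennreal (\<bar>c j l'\<bar> powr p))"
  define B' where "B' = (\<Sum>\<^sub>\<infinity>j'\<in>UNIV - {j}. ?X c j')"
  have "level_sum I p c j = ennreal (\<bar>c j l\<bar> powr p) + D'"
    unfolding level_sum_def D'_def by (rule infsum_remove_ennreal[OF l])
  then obtain D where D: "D \<ge> 0" "D' = ennreal D"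
    using level_sum_finite[OF pq fin, of j] by (cases D') auto
  have "(\<Sum>\<^sub>\<infinity>j. ?X c j) = ?X c j + B'"
    unfolding B'_def by (rule infsum_remove_ennreal) simp
  then obtain B where B: "B \<ge> 0" "B' = ennreal B"
    using fin pq by (cases B') (auto simp: besov_seq_norm_finite_exponents)
  show ?thesis
  proof (rule that[OF B(1) D(1)])
    fix c' assume eq: "\<And>j' l'. l' \<in> I j' \<Longrightarrow> (j', l') \<noteq> (j, l) \<Longrightarrow> c' j' l' = c j' l'"
    have "level_sum I p c' j = ennreal (\<bar>c' j l\<bar> powr p) + (\<Sum>\<^sub>\<infinity>l'\<in>I j - {l}. ennreal (\<bar>c' j l'\<bar> powr p))"
      unfolding level_sum_def by (rule infsum_remove_ennreal[OF l])
    also have "(\<Sum>\<^sub>\<infinity>l'\<in>I j - {l}. ennreal (\<bar>c' j l'\<bar> powr p)) = D'"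
      unfolding D'_def by (intro infsum_cong) (auto simp: eq)
    finally have lvl: "level_sum I p c' j = ennreal (\<bar>c' j l\<bar> powr p + D)"
      using D by simp
    have "level_sum I p c' j' = level_sum I p c j'" if "j' \<noteq> j" for j'
      unfolding level_sum_def using that by (intro infsum_cong) (auto simp: eq)
    then have "(\<Sum>\<^sub>\<infinity>j'\<in>UNIV - {j}. ?X c' j') = B'"
      unfolding B'_def by (intro infsum_cong) auto
    then have "(\<Sum>\<^sub>\<infinity>j. ?X c' j) = ?X c' j + B'"
      using infsum_remove_ennreal[of j UNIV "?X c'"] by simp
    moreover have "?X c' j = ennreal ((besov_weight d s p j * (\<bar>c' j l\<bar> powr p + D) powr (1/p)) powr q)"
      using D(1) besov_weight_pos[of d s p j] by (simp add: lvl del: ennreal_plus flip: ennreal_mult)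
    ultimately show "level_sum I p c' j = ennreal (\<bar>c' j l\<bar> powr p + D) \<and>
       besov_seq_norm d I s (ennreal p) (ennreal q) c' =
         ennreal ((B + (besov_weight d s p j * (\<bar>c' j l\<bar> powr p + D) powr (1/p)) powr q) powr (1/q))"
      using lvl B D pq by (simp add: besov_seq_norm_finite_exponents add.commute flip: ennreal_plus)
  qed
qed


section \<open>Subgradients of the sequence norm along a coordinate\<close>

lemma besov_seq_norm_cong:
  assumes "\<And>j l. l \<in> I j \<Longrightarrow> c j l = c' j l"
  shows "besov_seq_norm d I s p q c = besov_seq_norm d I s p q c'"
proof -
  have "lq_norm p (I j) (\<lambda>l. ennreal \<bar>c j l\<bar>) = lq_norm p (I j) (\<lambda>l. ennreal \<bar>c' j l\<bar>)" for j
    unfolding lq_norm_def using assms by (auto intro!: SUP_cong infsum_cong arg_cong2[where f=epowr])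
  then show ?thesis unfolding besov_seq_norm_def by simp
qed

text \<open>The inequality for all real \<open>t\<close> says that \<open>G t - t * v\<close> has a
  global minimum at 0. Its derivative vanishes there, so \<open>v\<close> equals the derivative of
  \<open>G\<close> at 0.\<close>

lemma besov_seq_norm_subgradient:
  assumes "1 < p" "1 < q" "1 < r" and fin: "besov_seq_norm d I s (ennreal p) (ennreal q) c < \<infinity>"
    and l: "l \<in> I j"
  defines "N \<equiv> \<lambda>c. enn2real (besov_seq_norm d I s (ennreal p) (ennreal q) c)"
  assumes sub: "\<And>t. (1/r) * N c powr r + t * v \<le>
    (1/r) * N (\<lambda>j' l'. c j' l' + (if j' = j \<and> l' = l then t else 0)) powr r"
  shows "\<bar>v\<bar> = N c powr (r - q) * besov_weight d s p j powr q *
    enn2real (level_sum I p c j) powr (q/p - 1) * \<bar>c j l\<bar> powr (p - 1)"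
proof -
  let ?c = "\<lambda>t j' l'. c j' l' + (if j' = j \<and> l' = l then t else 0)"
  let ?w = "besov_weight d s p j"
  obtain B D where BD: "0 \<le> B" "0 \<le> D" and
    *: "\<And>c'. (\<And>j' l'. l' \<in> I j' \<Longrightarrow> (j', l') \<noteq> (j, l) \<Longrightarrow> c' j' l' = c j' l') \<Longrightarrow>
       level_sum I p c' j = ennreal (\<bar>c' j l\<bar> powr p + D) \<and>
       besov_seq_norm d I s (ennreal p) (ennreal q) c' =
         ennreal ((B + (?w * (\<bar>c' j l\<bar> powr p + D) powr (1/p)) powr q) powr (1/q))"
    using besov_seq_norm_change_coefficient[OF _ _ fin l] assms(1,2) by (smt (verit))
  define G where "G = (\<lambda>t. (1/r) * ((B + (?w * (\<bar>c j l + t\<bar> powr p + D) powr (1/p)) powr q) powr (1/q)) powr r)"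
  have Nt: "N (?c t) = (B + (?w * (\<bar>c j l + t\<bar> powr p + D) powr (1/p)) powr q) powr (1/q)" for t
  proof -
    have "besov_seq_norm d I s (ennreal p) (ennreal q) (?c t) =
        ennreal ((B + (?w * (\<bar>?c t j l\<bar> powr p + D) powr (1/p)) powr q) powr (1/q))"
      by (rule conjunct2[OF *]) auto
    then show ?thesis by (simp add: N_def)
  qed
  have Nc: "N c = (B + (?w * (\<bar>c j l\<bar> powr p + D) powr (1/p)) powr q) powr (1/q)"
    using Nt[of 0] by simp
  have S: "enn2real (level_sum I p c j) = \<bar>c j l\<bar> powr p + D"
    using *[of c] BD by (simp del: ennreal_plus)
  have "(G has_real_derivative N c powr (r - q) * ?w powr q *
      (\<bar>c j l\<bar> powr p + D) powr (q/p - 1) * \<bar>c j l\<bar> powr (p - 1) * sgn (c j l)) (at 0)"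
    unfolding G_def Nc
    by (rule has_real_derivative_mixed_norm_powr) (use assms BD besov_weight_pos in auto)
  then have "((\<lambda>t. G t - t * v) has_real_derivative N c powr (r - q) * ?w powr q *
      (\<bar>c j l\<bar> powr p + D) powr (q/p - 1) * \<bar>c j l\<bar> powr (p - 1) * sgn (c j l) - v) (at 0)"
    by (auto intro!: derivative_eq_intros)
  moreover have "G 0 - 0 * v \<le> G t - t * v" for t
    using sub[of t] unfolding Nt Nc by (simp add: G_def)
  ultimately have "N c powr (r - q) * ?w powr q *
      (\<bar>c j l\<bar> powr p + D) powr (q/p - 1) * \<bar>c j l\<bar> powr (p - 1) * sgn (c j l) - v = 0"
    by (intro DERIV_local_min[where d=1]) auto
  then have "v = N c powr (r - q) * ?w powr q *
      (\<bar>c j l\<bar> powr p + D) powr (q/p - 1) * \<bar>c j l\<bar> powr (p - 1) * sgn (c j l)" by simp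
  \<comment> \<open>If \<open>c j l = 0\<close>, the lost factor
    \<open>\<bar>sgn (c j l)\<bar>\<close> does no harm, because \<open>0 powr (p - 1) = 0\<close>
    already.\<close>
  then show ?thesis unfolding S
    by (simp add: abs_mult abs_sgn_eq)
qed

section \<open>The norm identity for dual coefficient sequences\<close>

text \<open>Passing from \<open>p\<close> to its conjugate exponent flips the sign of
  \<open>1/2 - 1/p\<close>, so the dimensional exponents add up to \<open>q - 1\<close> times that
  term. The smoothness exponents add up to \<open>s2 * (q - 1)\<close>, which is what determines
  \<open>s3\<close>.\<close>

lemma besov_weight_dual:
  assumes "0 < p"
  shows "besov_weight d (- s1 + (s2 - s1) * (q - 1)) (p / (p - 1)) j * besov_weight d s1 p j powr q
    = besov_weight d s2 p j powr (q - 1)"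
proof -
  have "1 / (p / (p - 1)) = 1 - 1 / p" using assms by (simp add: field_simps)
  then show ?thesis
    by (simp add: besov_weight_def powr_powr powr_mult flip: powr_add) (simp add: algebra_simps diff_divide_distrib add_divide_distrib)
qed

lemma besov_seq_norm_dual:
  fixes k :: real
  assumes "1 < p" "1 < q" "1 \<le> q2" "0 \<le> k"
    and fin: "\<And>j. level_sum I p c j < \<infinity>"
    and v: "\<And>j l. l \<in> I j \<Longrightarrow> \<bar>v j l\<bar> = k * besov_weight d s1 p j powr q *
      enn2real (level_sum I p c j) powr (q/p - 1) * \<bar>c j l\<bar> powr (p - 1)"
  shows "besov_seq_norm d I (- s1 + (s2 - s1) * (q - 1)) (ennreal (p / (p - 1))) (q2 / ennreal (q - 1)) v =
    ennreal k * epowr (besov_seq_norm d I s2 (ennreal p) q2 c) (q - 1)"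
proof -
  let ?p' = "p / (p - 1)" and ?s3 = "- s1 + (s2 - s1) * (q - 1)"
  define S where "S j = enn2real (level_sum I p c j)" for j
  have S: "level_sum I p c j = ennreal (S j)" "S j \<ge> 0" for j
    using fin[of j] by (simp_all add: S_def)
  define K where "K j = k * besov_weight d s1 p j powr q * S j powr (q/p - 1)" for j
  have K0: "K j \<ge> 0" for j using assms by (simp add: K_def)
  have "level_sum I ?p' v j = ennreal (K j powr ?p' * S j)" for j
  proof -
    \<comment> \<open>On a fixed level \<open>\<bar>v j l\<bar>\<close> is
      \<open>K j * \<bar>c j l\<bar> powr (p - 1)\<close>, and
      \<open>(p - 1) * ?p' = p\<close>.\<close>
    have "level_sum I ?p' v j = (\<Sum>\<^sub>\<infinity>l\<in>I j. ennreal (K j powr ?p') * ennreal (\<bar>c j l\<bar> powr p))"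
      unfolding level_sum_def
      using assms K0[of j] by (intro infsum_cong) (simp add: v powr_mult powr_powr K_def S_def flip: ennreal_mult)
    also have "\<dots> = ennreal (K j powr ?p') * level_sum I p c j"
      unfolding level_sum_def by (rule infsum_cmult_ennreal)
    finally show ?thesis by (simp add: S ennreal_mult)
  qed
  moreover have "besov_weight d ?s3 ?p' j * (K j powr ?p' * S j) powr (1/?p')
      = k * (besov_weight d s2 p j * S j powr (1/p)) powr (q - 1)" for j
  proof -
    have e: "(q/p - 1) + (1 - 1/p) = (q - 1)/p" "1 / ?p' = 1 - 1/p" using assms by (simp_all add: field_simps)
    have "(K j powr ?p' * S j) powr (1/?p') = K j * S j powr (1 - 1/p)"
      using assms K0[of j] S(2)[of j] unfolding e(2)[symmetric] by (simp add: powr_mult powr_powr)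
    \<comment> \<open>The exponents of \<open>S j\<close> combine also when \<open>S j = 0\<close>,
      where \<open>q/p - 1\<close> may be negative: every power of 0 is read as 0.\<close>
    also have "\<dots> = k * besov_weight d s1 p j powr q * S j powr ((q - 1)/p)"
      unfolding K_def using e(1) powr_add[of "S j" "q/p - 1" "1 - 1/p"] by simp
    finally have "besov_weight d ?s3 ?p' j * (K j powr ?p' * S j) powr (1/?p')
      = k * (besov_weight d ?s3 ?p' j * besov_weight d s1 p j powr q) * S j powr ((q - 1)/p)"
      by simp
    also have "\<dots> = k * besov_weight d s2 p j powr (q - 1) * S j powr ((q - 1)/p)"
      using assms(1) by (subst besov_weight_dual) auto
    finally show ?thesis
      using besov_weight_pos[of d s2 p j] S(2)[of j] by (simp add: powr_mult powr_powr)
  qed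
  ultimately have "besov_seq_norm d I ?s3 (ennreal ?p') (q2 / ennreal (q - 1)) v =
     lq_norm (q2 / ennreal (q - 1)) UNIV (\<lambda>j. ennreal (k * (besov_weight d s2 p j * S j powr (1/p)) powr (q - 1)))"
    using assms S(2) K0 less_imp_le[OF besov_weight_pos]
    by (subst besov_seq_norm_level_sum) (simp_all flip: ennreal_mult)
  also have "\<dots> = ennreal k * epowr (lq_norm q2 UNIV (\<lambda>j. ennreal (besov_weight d s2 p j * S j powr (1/p)))) (q - 1)"
    using assms S(2) less_imp_le[OF besov_weight_pos] by (intro lq_norm_cmult_powr) auto
  also have "lq_norm q2 UNIV (\<lambda>j. ennreal (besov_weight d s2 p j * S j powr (1/p)))
     = besov_seq_norm d I s2 (ennreal p) q2 c"
    using assms S(2) less_imp_le[OF besov_weight_pos]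
    by (subst besov_seq_norm_level_sum) (simp_all add: S ennreal_mult)
  finally show ?thesis .
qed

text \<open>All weights are positive, so a zero norm forces every level sum to vanish, and the level
  sums involve neither the smoothness nor the outer exponent. This handles the degenerate case of
  the final equivalence.\<close>

lemma besov_seq_norm_eq_0D:
  assumes "1 < p" "1 < q" "besov_seq_norm d I s (ennreal p) (ennreal q) c = 0"
  shows "besov_seq_norm d I s' (ennreal p) q' c = 0"
proof -
  have "level_sum I p c j = 0" for j
  proof -
    let ?X = "\<lambda>j. epowr (ennreal (besov_weight d s p j) * epowr (level_sum I p c j) (1/p)) q"
    have eq0: "epowr x a = 0 \<longleftrightarrow> x = 0" for x a by (cases x) auto
    have "infsum ?X UNIV = 0"
      using assms by (simp add: besov_seq_norm_finite_exponents eq0)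
    then have "?X j = 0" by (simp add: infsum_remove_ennreal[of j UNIV])
    then show ?thesis using besov_weight_pos[of d s p j] by (simp add: eq0)
  qed
  then show ?thesis using assms by (simp add: besov_seq_norm_level_sum lq_norm_def)
qed

section \<open>From coefficient sequences to distributions\<close>

text \<open>On a bounded domain the function extends continuously to the compact closure; on the
  torus the cell is a compact cube. Integrability makes each wavelet a regular distribution to which
  the dual pairing applies.\<close>

lemma Ck_closure_set_integrable:
  fixes R :: "(real^'n) region"
  assumes "admissible_region R" "\<psi> \<in> Ck_closure k R"
  shows "set_integrable lborel (cell R) \<psi>"
proof (cases R)
  case (Bounded_Domain D)
  then have D: "open D" "bounded D"
    using assms by (auto simp: admissible_region_def bounded_lipschitz_domain_def)
  \<comment> \<open>The empty list of directions selects the function itself among its partial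
    derivatives.\<close>
  from assms Bounded_Domain obtain g
    where g: "continuous_on (closure D) g" "\<And>x. x \<in> D \<Longrightarrow> g x = \<psi> x"
    unfolding Ck_closure_def by (force dest: spec[where x="[]"])
  have "set_integrable lborel (closure D) g"
    unfolding set_integrable_def using D g by (intro borel_integrable_compact) auto
  then have "set_integrable lborel D g"
    by (rule set_integrable_subset) (use D closure_subset in auto)
  also have "?this \<longleftrightarrow> set_integrable lborel D \<psi>"
    using g by (intro set_integrable_cong) auto
  finally show ?thesis using Bounded_Domain by (simp add: cell_def)
next
  case Torus
  with assms have "continuous_on UNIV \<psi>"
    by (auto simp: Ck_closure_def Ck_on_def dest: spec[where x="[]"])
  then have "continuous_on (cbox 0 1) \<psi>" by (rule continuous_on_subset) simp
  with Torus show ?thesis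
    using borel_integrable_compact[OF compact_cbox, of 0 1 \<psi>] by (simp add: set_integrable_def cell_def)
qed

text \<open>By orthonormality, a multiple of one wavelet affects only its own coefficient. The
  scalar \<open>a\<close> is 1 for the perturbed point and 0 for the bare increment; the subgradient
  inequality involves both.\<close>

lemma coeff_add_wavelet:
  assumes W: "besov_wavelet_system W" and f: "f \<in> pairable W"
    and l: "l \<in> idx W j" "l' \<in> idx W j'"
  shows "coeff W j' l' (lin_comb a f t (regular_distribution (region W) (wavelet W j l)))
    = a * coeff W j' l' f + (if j' = j \<and> l' = l then t else 0)"
    and "lin_comb a f t (regular_distribution (region W) (wavelet W j l)) \<in> pairable W"
proof -
  let ?u = "regular_distribution (region W) (wavelet W j l)"
  have mem: "wavelet W j l \<in> Ck_closure (smoothness W) (region W)"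
    "wavelet W j' l' \<in> Ck_closure (smoothness W) (region W)"
    and orth: "(LINT x:cell (region W)|lborel. wavelet W j l x * wavelet W j' l' x)
          = (if j = j' \<and> l = l' then 1 else 0)"
    using W l by (auto simp: besov_wavelet_system_def orthonormal_wavelets_def)
  have "set_integrable lborel (cell (region W)) (wavelet W j l)"
    using Ck_closure_set_integrable mem W by (auto simp: besov_wavelet_system_def)
  then have u: "?u \<in> pairable W" and
    *: "\<forall>\<psi>\<in>Ck_closure (smoothness W) (region W).
       pairing W ?u \<psi> = (LINT x:cell (region W)|lborel. wavelet W j l x * \<psi> x)"
    using W unfolding besov_wavelet_system_def dual_pairing_def by blast+
  show "lin_comb a f t ?u \<in> pairable W"
    using W u f by (auto simp: besov_wavelet_system_def dual_pairing_def linear_space_def)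
  have "linear_functional_on (pairable W) (\<lambda>u. pairing W u (wavelet W j' l'))"
    using W mem by (auto simp: besov_wavelet_system_def dual_pairing_def)
  then have "coeff W j' l' (lin_comb a f t ?u) = a * coeff W j' l' f + t * coeff W j' l' ?u"
    using u f by (auto simp: linear_functional_on_def coeff_def)
  then show "coeff W j' l' (lin_comb a f t ?u) = a * coeff W j' l' f + (if j' = j \<and> l' = l then t else 0)"
    using * mem orth by (auto simp: coeff_def)
qed

text \<open>One description for all exponents: the generating property covers those at least 1, the
  definition of \<open>besov\<close> the quasi-normed spaces that \<open>q3 < 1\<close>
  requires.\<close>

lemma besov_eq_wavelet_norm_finite:
  assumes "besov_wavelet_system W" "\<bar>s\<bar> < real (smoothness W)"
  shows "besov W s p q = {u \<in> pairable W. wavelet_norm W s p q u < \<infinity>}"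
  using assms by (simp add: besov_def besov_wavelet_system_def generates_besov_spaces_def)

text \<open>The perturbed coefficient family of \<open>besov_seq_norm_subgradient\<close> is
  realised by adding a multiple of a wavelet to \<open>f\<close>, and \<open>v\<close> acts on this
  increment through its coefficient at \<open>(j, l)\<close> alone.\<close>

lemma besov_subdifferential_coeff:
  fixes W :: "(real^'n, 'l) wavelet_setting"
  assumes W: "besov_wavelet_system W" and "1 < p" "1 < q" "1 < r" "\<bar>s\<bar> < real (smoothness W)"
    and f: "f \<in> besov W s (ennreal p) (ennreal q)"
    and v: "v \<in> besov_subdifferential W s p q r f"
    and l: "l \<in> idx W j"
  shows "\<bar>coeff W j l v\<bar> = enn2real (wavelet_norm W s (ennreal p) (ennreal q) f) powr (r - q) *
    besov_weight CARD('n) s p j powr q *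
    enn2real (level_sum (idx W) p (\<lambda>j l. coeff W j l f) j) powr (q/p - 1) *
    \<bar>coeff W j l f\<bar> powr (p - 1)"
  unfolding wavelet_norm_def
proof (rule besov_seq_norm_subgradient)
  let ?N = "besov_seq_norm CARD('n) (idx W) s (ennreal p) (ennreal q)"
  let ?c = "\<lambda>j l. coeff W j l f" and ?u = "regular_distribution (region W) (wavelet W j l)"
  have f': "f \<in> pairable W" "?N ?c < \<infinity>"
    using f assms by (simp_all add: besov_eq_wavelet_norm_finite wavelet_norm_def)
  then show "?N ?c < \<infinity>" by simp
  fix t
  let ?d = "\<lambda>j' l'. ?c j' l' + (if j' = j \<and> l' = l then t else 0)"
  let ?g = "lin_comb 1 f t ?u"
  have Ng: "wavelet_norm W s (ennreal p) (ennreal q) ?g = ?N ?d"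
    unfolding wavelet_norm_def
    by (rule besov_seq_norm_cong) (simp add: coeff_add_wavelet[OF W f'(1) l])
  obtain B D where change: "\<And>c'. (\<And>j' l'. l' \<in> idx W j' \<Longrightarrow> (j', l') \<noteq> (j, l) \<Longrightarrow> c' j' l' = ?c j' l') \<Longrightarrow>
       ?N c' = ennreal ((B + (besov_weight CARD('n) s p j * (\<bar>c' j l\<bar> powr p + D) powr (1/p)) powr q) powr (1/q))"
    using besov_seq_norm_change_coefficient[OF _ _ f'(2) l] assms(2,3) by (smt (verit))
  \<comment> \<open>One changed coefficient keeps the norm finite, so \<open>?g\<close> may be
    inserted into the subgradient inequality.\<close>
  have "?N ?d < \<infinity>" by (subst change) auto
  then have g: "?g \<in> besov W s (ennreal p) (ennreal q)"
    using assms Ng coeff_add_wavelet(2)[OF W f'(1) l l] by (simp add: besov_eq_wavelet_norm_finite)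
  have "lin_comb 1 ?g (-1) f = lin_comb 0 f t ?u"
    by (simp add: lin_comb_def)
  then have "dual_functional W v (lin_comb 1 ?g (-1) f) =
     (\<Sum>\<^sub>\<infinity>(j', l')\<in>(SIGMA j:UNIV. idx W j). coeff W j' l' v * (if j' = j \<and> l' = l then t else 0))"
    unfolding dual_functional_def
    by (auto intro!: infsum_cong simp: coeff_add_wavelet[OF W f'(1) l])
  \<comment> \<open>All terms off \<open>(j, l)\<close> are zero, so the series reduces to a finite
    sum without a separate summability argument.\<close>
  also have "\<dots> = (\<Sum>\<^sub>\<infinity>(j', l')\<in>{(j, l)}. coeff W j' l' v * (if j' = j \<and> l' = l then t else 0))"
    using l by (intro infsum_cong_neutral) (auto split: if_splits)
  finally have dual: "dual_functional W v (lin_comb 1 ?g (-1) f) = t * coeff W j l v"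
    by simp
  show "(1/r) * enn2real (?N ?c) powr r + t * coeff W j l v \<le> (1/r) * enn2real (?N ?d) powr r"
    using v g dual Ng unfolding besov_subdifferential_def subdifferential_def wavelet_norm_def[of _ _ _ _ f]
    by fastforce
qed (use assms in auto)

theorem theorem3p6:
  fixes W :: "(real^'n, 'l) wavelet_setting"
    and p q1 r s1 s2 s3 p' q1' :: real
    and q2 q3 :: ennreal
    and f fstar :: "(real^'n \<Rightarrow> real) \<Rightarrow> real"
  assumes "besov_wavelet_system W"
    and "1 < p" "1 < q1" "1 \<le> q2" "1 < r"
    and "p' = p / (p - 1)" "q1' = q1 / (q1 - 1)"
    and "s3 = - s1 + (s2 - s1) * (q1 - 1)"
    and "q3 = q2 / ennreal (q1 - 1)"
    and "real (smoothness W) > Max {\<bar>s1\<bar>, \<bar>s2\<bar>, \<bar>s3\<bar>}"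
    and "f \<in> besov W s1 (ennreal p) (ennreal q1)"
    and "fstar \<in> besov_subdifferential W s1 p q1 r f"
  shows "(f \<in> besov W s1 (ennreal p) (ennreal q1) \<inter> besov W s2 (ennreal p) q2 \<longleftrightarrow>
          fstar \<in> besov W (- s1) (ennreal p') (ennreal q1') \<inter> besov W s3 (ennreal p') q3) \<and>
         wavelet_norm W s3 (ennreal p') q3 fstar =
           epowr (wavelet_norm W s1 (ennreal p) (ennreal q1) f) (r - q1) *
           epowr (wavelet_norm W s2 (ennreal p) q2 f) (q1 - 1)"
proof -
  have s: "\<bar>s1\<bar> < real (smoothness W)" "\<bar>s2\<bar> < real (smoothness W)" "\<bar>s3\<bar> < real (smoothness W)"
    using assms(10) by auto
  note eq = besov_eq_wavelet_norm_finite[OF assms(1)]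
  let ?N = "wavelet_norm W s1 (ennreal p) (ennreal q1) f"
  let ?M = "wavelet_norm W s2 (ennreal p) q2 f"
  have f: "f \<in> pairable W" "?N < \<infinity>"
    using assms(11) s by (simp_all add: eq)
  have fstar: "fstar \<in> besov W (- s1) (ennreal p') (ennreal q1')" "fstar \<in> pairable W"
    using assms(6,7,12) s by (auto simp: besov_subdifferential_def eq)
  \<comment> \<open>Finiteness of \<open>?N\<close> keeps this factor finite even for negative
    \<open>r - q1\<close>; at \<open>?N = 0\<close> it is 0 for every exponent.\<close>
  have N: "epowr ?N (r - q1) = ennreal (enn2real ?N powr (r - q1))"
    using f(2) by (auto simp: epowr_def)
  have identity: "wavelet_norm W s3 (ennreal p') q3 fstar = epowr ?N (r - q1) * epowr ?M (q1 - 1)"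
    unfolding N assms(6,8,9) wavelet_norm_def[of W _ "ennreal (p / (p - 1))"] wavelet_norm_def[of W s2]
  proof (rule besov_seq_norm_dual)
    show "level_sum (idx W) p (\<lambda>j l. coeff W j l f) j < \<infinity>" for j
      using level_sum_finite[of p q1] assms f(2) by (simp add: wavelet_norm_def)
  qed (use assms s in \<open>auto simp: besov_subdifferential_coeff\<close>)
  \<comment> \<open>The memberships in the first space of each intersection are already known, so
    the equivalence reduces to this one. For \<open>?N = 0\<close> the identity alone would not
    decide it, since \<open>0 * top = 0\<close>; there \<open>?M\<close> vanishes as well. Otherwise
    the factor in front is positive and finite.\<close>
  have "wavelet_norm W s3 (ennreal p') q3 fstar < \<infinity> \<longleftrightarrow> ?M < \<infinity>"
  proof (cases "?N = 0")
    case True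
    then have "?M = 0"
      using assms(2,3) besov_seq_norm_eq_0D by (auto simp: wavelet_norm_def)
    then show ?thesis by (simp add: identity)
  next
    case False
    then have "enn2real ?N > 0" using f(2) by (simp add: enn2real_positive_iff less_top zero_less_iff_neq_zero)
    then show ?thesis unfolding identity N
      by (cases ?M) (auto simp: ennreal_mult_top simp flip: ennreal_mult)
  qed
  then show ?thesis
    using f fstar s assms(11) identity by (auto simp: eq)
qed

end
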